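(* Let $h\colon\mathcal{X}\to\mathcal{Y}$ be a classifier and $\lambda>0$ a target risk. Consider the problem $$\max_{c\in[0,1]^{\mathcal{X}}}\ \phi(c)\quad\text{s.t.}\quad R_S(h,c)\le\lambda, \qquad (P)$$ and assume that a maximizer exists. Let $r(x)=\sum_{y\in\mathcal{Y}}p(y\mid x)\,\ell(y,h(x))$, $\bar r(x)=r(x)-\lambda$, let $\rho(\mathcal{X}')=\int_{\mathcal{X}'}p(x)\bar r(x)\,dx$ for $\mathcal{X}'\subseteq\mathcal{X}$, and let $$b=\sup\{a\mid\rho(\mathcal{X}_{\bar r(x)\le a})\le 0\}\ge 0 .$$ Then a selection function $c^*\colon\mathcal{X}\to[0,1]$ is an optimal solution to $(P)$ if and only if $$\int_{\mathcal{X}_{\bar r(x)<b}}p(x)c^*(x)\,dx=\int_{\mathcal{X}_{\bar r(x)<b}}p(x)\,dx,$$ $$\int_{\mathcal{X}_{\bar r(x)=b}}p(x)c^*(x)\,dx=\begin{cases}-\dfrac{\rho(\mathcal{X}_{\bar r(x)<b})}{b}&\text{if } b>0,\\[2mm] \displaystyle\int_{\mathcal{X}_{\bar r(x)=0}}p(x)\,dx&\text{if } b=0,\end{cases}$$ $$\int_{\mathcal{X}_{\bar r(x)>b}}p(x)c^*(x)\,dx=0 .$$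
   Context: $\mathcal{X}$ is a set of inputs (a measurable space with a fixed reference measure $dx$), $\mathcal{Y}$ is a finite set of labels, $p(x,y)$ is a probability density on $\mathcal{X}\times\mathcal{Y}$ (with respect to $dx$ times counting measure), $p(x)=\sum_{y\in\mathcal{Y}}p(x,y)$ is its marginal, and $p(y\mid x)$ is the conditional distribution, so $p(x,y)=p(x)p(y\mid x)$. $\ell\colon\mathcal{Y}\times\mathcal{Y}\to[0,\infty)$ is a loss. A classifier is a function $h\colon\mathcal{X}\to\mathcal{Y}$, a selection function is a function $c\colon\mathcal{X}\to[0,1]$; all functions and sets are taken measurable. The coverage of $c$ is $\phi(c)=\int_{\mathcal{X}}p(x)c(x)\,dx$, and the selective risk of $(h,c)$ is $$R_S(h,c)=\frac{\int_{\mathcal{X}}\sum_{y\in\mathcal{Y}}p(x,y)\,\ell(y,h(x))\,c(x)\,dx}{\phi(c)},$$ defined when $\phi(c)\neq 0$; $c$ is feasible only if $R_S(h,c)$ is defined. For $f\colon\mathcal{X}\to\mathbb{R}$ and $a\in\mathbb{R}\cup\{\infty\}$, $\mathcal{X}_{f(x)\le a}=\{x\in\mathcal{X}\mid f(x)\le a\}$, and similarly for $<,=,>,\ge$. The supremum $b$ is taken in $\mathbb{R}\cup\{\infty\}$; if $b=\infty$ then $\rho(\mathcal{X}_{\bar r(x)<b})/b$ is read as $0$. *)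

theory Defs
  imports "HOL-Probability.Probability"
begin

(* The input space is space M, with reference measure M; the label set is the finite type 'y. *)

definition joint_density :: "'x measure \<Rightarrow> ('x \<times> 'y::finite \<Rightarrow> real) \<Rightarrow> bool" where
  "joint_density M p \<longleftrightarrow>
     p \<in> borel_measurable (M \<Otimes>\<^sub>M count_space UNIV) \<and>
     (\<forall>x\<in>space M. \<forall>y. 0 \<le> p (x, y)) \<and>
     prob_space (density (M \<Otimes>\<^sub>M count_space UNIV) (\<lambda>z. ennreal (p z)))"

definition marginal :: "('x \<times> 'y::finite \<Rightarrow> real) \<Rightarrow> 'x \<Rightarrow> real" where
  "marginal p x = (\<Sum>y\<in>UNIV. p (x, y))"

(* q y x is p(y | x). The values at points of marginal density 0 are left open,
   apart from q _ x being a probability vector. *)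
definition conditional_distribution ::
  "'x measure \<Rightarrow> ('x \<times> 'y::finite \<Rightarrow> real) \<Rightarrow> ('y \<Rightarrow> 'x \<Rightarrow> real) \<Rightarrow> bool" where
  "conditional_distribution M p q \<longleftrightarrow>
     (\<forall>y. q y \<in> borel_measurable M) \<and>
     (\<forall>x\<in>space M. (\<forall>y. 0 \<le> q y x) \<and> (\<Sum>y\<in>UNIV. q y x) = 1) \<and>
     (\<forall>x\<in>space M. \<forall>y. p (x, y) = marginal p x * q y x)"

definition selection_function :: "'x measure \<Rightarrow> ('x \<Rightarrow> real) \<Rightarrow> bool" where
  "selection_function M c \<longleftrightarrow> c \<in> borel_measurable M \<and> (\<forall>x\<in>space M. c x \<in> {0..1})"

definition coverage ::
  "'x measure \<Rightarrow> ('x \<times> 'y::finite \<Rightarrow> real) \<Rightarrow> ('x \<Rightarrow> real) \<Rightarrow> real" where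
  "coverage M p c = (LINT x|M. marginal p x * c x)"

(* Meaningful only if coverage M p c is nonzero; feasible imposes this. *)
definition selective_risk ::
  "'x measure \<Rightarrow> ('x \<times> 'y::finite \<Rightarrow> real) \<Rightarrow> ('y \<Rightarrow> 'y \<Rightarrow> real) \<Rightarrow> ('x \<Rightarrow> 'y) \<Rightarrow> ('x \<Rightarrow> real) \<Rightarrow> real"
  where
  "selective_risk M p loss h c =
     (LINT x|M. (\<Sum>y\<in>UNIV. p (x, y) * loss y (h x) * c x)) / coverage M p c"

definition feasible ::
  "'x measure \<Rightarrow> ('x \<times> 'y::finite \<Rightarrow> real) \<Rightarrow> ('y \<Rightarrow> 'y \<Rightarrow> real) \<Rightarrow> ('x \<Rightarrow> 'y) \<Rightarrow> real \<Rightarrow> ('x \<Rightarrow> real) \<Rightarrow> bool"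
  where
  "feasible M p loss h target c \<longleftrightarrow>
     selection_function M c \<and> coverage M p c \<noteq> 0 \<and> selective_risk M p loss h c \<le> target"

definition optimal ::
  "'x measure \<Rightarrow> ('x \<times> 'y::finite \<Rightarrow> real) \<Rightarrow> ('y \<Rightarrow> 'y \<Rightarrow> real) \<Rightarrow> ('x \<Rightarrow> 'y) \<Rightarrow> real \<Rightarrow> ('x \<Rightarrow> real) \<Rightarrow> bool"
  where
  "optimal M p loss h target c \<longleftrightarrow>
     feasible M p loss h target c \<and>
     (\<forall>c'. feasible M p loss h target c' \<longrightarrow> coverage M p c' \<le> coverage M p c)"

definition conditional_risk ::
  "('y::finite \<Rightarrow> 'x \<Rightarrow> real) \<Rightarrow> ('y \<Rightarrow> 'y \<Rightarrow> real) \<Rightarrow> ('x \<Rightarrow> 'y) \<Rightarrow> 'x \<Rightarrow> real" where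
  "conditional_risk q loss h x = (\<Sum>y\<in>UNIV. q y x * loss y (h x))"

(* rbar is conditional_risk - target. *)
definition rho ::
  "'x measure \<Rightarrow> ('x \<times> 'y::finite \<Rightarrow> real) \<Rightarrow> ('x \<Rightarrow> real) \<Rightarrow> 'x set \<Rightarrow> real" where
  "rho M p rbar A = (LINT x:A|M. marginal p x * rbar x)"

(* The supremum ranges over real a and a = \<infinity>, hence the exclusion of -\<infinity>. *)
definition threshold ::
  "'x measure \<Rightarrow> ('x \<times> 'y::finite \<Rightarrow> real) \<Rightarrow> ('x \<Rightarrow> real) \<Rightarrow> ereal" where
  "threshold M p rbar =
     Sup {a. a \<noteq> -\<infinity> \<and> rho M p rbar {x \<in> space M. ereal (rbar x) \<le> a} \<le> 0}"

end

theory Submission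
  imports Defs
begin

text \<open>
  Let \<open>N\<close> be the marginal distribution of the inputs and \<open>g\<close> the excess risk, which is bounded because
  there are finitely many labels. Then \<open>c\<close> is feasible iff \<open>\<integral> c dN > 0\<close> and
  \<open>\<integral> g c dN \<le> 0\<close>. If the threshold is infinite, \<open>c = 1\<close> is feasible. If it is a real \<open>\<beta>\<close>, one-sided
  continuity gives \<open>\<rho>(g < \<beta>) \<le> 0 \<le> \<rho>(g \<le> \<beta>)\<close>, so the prescribed mass \<open>E\<close> on \<open>{g = \<beta>}\<close> lies between
  \<open>0\<close> and \<open>N(g = \<beta>)\<close> and satisfies \<open>\<rho>(g < \<beta>) + \<beta> E = 0\<close>. With \<open>V = N(g < \<beta>) + E\<close> this turns the
  nonnegative Lagrangian slack \<open>\<integral> (1[g < \<beta>] - c) (\<beta> - g) dN\<close> into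
  \<open>\<beta> (V - \<integral> c dN) + \<integral> g c dN\<close>. Hence no feasible coverage exceeds \<open>V\<close>; equality forces the slack to
  vanish, that is, \<open>c = 1\<close> a.e. on \<open>{g < \<beta>}\<close> and \<open>c = 0\<close> a.e. on \<open>{g > \<beta>}\<close>. For \<open>\<beta> = 0\<close> the slack of
  every feasible \<open>c\<close> vanishes, and the bound comes from \<open>E = N(g = 0)\<close> instead.
\<close>

section \<open>Bounded scores on a finite measure space\<close>

locale bounded_score = finite_measure N for N :: "'x measure" +
  fixes g :: "'x \<Rightarrow> real" and K :: real
  assumes g_measurable [measurable]: "g \<in> borel_measurable N"
    and g_bounded: "x \<in> space N \<Longrightarrow> \<bar>g x\<bar> \<le> K"
begin

lemma integrable_bounded:
  fixes f :: "'x \<Rightarrow> real"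
  assumes [measurable]: "f \<in> borel_measurable N" and "\<And>x. x \<in> space N \<Longrightarrow> \<bar>f x\<bar> \<le> B"
  shows "integrable N f"
  using assms(2) by (intro integrable_const_bound[where B = B] AE_I2) auto

lemma integrable_g: "integrable N g"
  using g_bounded by (intro integrable_bounded) auto

section \<open>Score mass of sublevel sets and the critical level\<close>

definition mass_upto :: "ereal \<Rightarrow> real" where
  "mass_upto a = (LINT x:{x \<in> space N. ereal (g x) \<le> a}|N. g x)"

lemma indicator_g_bounded: "x \<in> space N \<Longrightarrow> norm (indicator A x *\<^sub>R g x) \<le> K"
  using g_bounded[of x] by (auto simp: indicator_def)

text \<open>On a sublevel set at a nonpositive level the score itself is nonpositive. This puts 0
  into the set whose supremum is \<open>crit\<close>, which makes \<open>crit\<close>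
  nonnegative.\<close>

lemma mass_upto_nonpos:
  assumes "a \<le> 0"
  shows "mass_upto a \<le> 0"
proof -
  have "0 \<le> (LINT x|N. - (indicator {x \<in> space N. ereal (g x) \<le> a} x *\<^sub>R g x))"
  proof (intro integral_nonneg_AE AE_I2)
    fix x
    have "g x \<le> 0" if "ereal (g x) \<le> a"
      using order_trans[OF that assms] by simp
    then show "0 \<le> - (indicator {x \<in> space N. ereal (g x) \<le> a} x *\<^sub>R g x)"
      by (auto simp: indicator_def)
  qed
  then show ?thesis by (simp only: Bochner_Integration.integral_minus mass_upto_def set_lebesgue_integral_def)
qed

text \<open>\<open>mass_upto\<close> is not monotone: raising the level adds negative scores first
  and positive ones later. At levels up to 0 the sign is known anyway, and raising a positive level
  only adds points of positive score. So the levels of nonpositive mass are closed downwards, and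
  every level below their supremum is one of them.\<close>

lemma mass_upto_nonpos_downward:
  assumes "a \<le> a'" "mass_upto a' \<le> 0"
  shows "mass_upto a \<le> 0"
proof (cases "a \<le> 0")
  case False
  have "mass_upto a \<le> mass_upto a'"
    unfolding mass_upto_def set_lebesgue_integral_def
  proof (rule integral_mono)
    show "indicator {x \<in> space N. ereal (g x) \<le> a} x *\<^sub>R g x
            \<le> indicator {x \<in> space N. ereal (g x) \<le> a'} x *\<^sub>R g x" if "x \<in> space N" for x
    proof (cases "g x \<le> 0")
      case True
      have "ereal (g x) \<le> 0" "0 \<le> a" using True False by simp_all
      then have "ereal (g x) \<le> a" by (rule order_trans)
      then show ?thesis using assms(1) that by (auto simp: indicator_def)
    next
      case False
      then show ?thesis using assms(1) by (auto simp: indicator_def)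
    qed
  qed (rule integrable_mult_indicator[OF _ integrable_g], measurable)+
  then show ?thesis using assms(2) by simp
qed (rule mass_upto_nonpos)

text \<open>Excludes -\<infinity> just as \<open>threshold\<close> does, so that the two agree once
  \<open>rho\<close> is rewritten as an integral against \<open>N\<close>.\<close>

abbreviation crit :: ereal where
  "crit \<equiv> Sup {a. a \<noteq> -\<infinity> \<and> mass_upto a \<le> 0}"

lemma crit_nonneg: "0 \<le> crit"
  by (rule Sup_upper) (simp add: mass_upto_nonpos)

lemma mass_upto_below_crit: "a < crit \<Longrightarrow> mass_upto a \<le> 0"
  by (auto simp: less_Sup_iff intro: mass_upto_nonpos_downward less_imp_le)

lemma mass_upto_above_crit: "crit < ereal a \<Longrightarrow> 0 < mass_upto (ereal a)"
  by (metis (mono_tags, lifting) MInfty_neq_ereal(1) Sup_upper linorder_not_le mem_Collect_eq)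

text \<open>The sublevel set at the finite level \<open>K\<close> is already the whole space, and a
  finite level lies strictly below an infinite \<open>crit\<close>.\<close>

lemma integral_nonpos_if_crit_infinite:
  assumes "crit = \<infinity>"
  shows "(LINT x|N. g x) \<le> 0"
proof -
  have "mass_upto (ereal K) \<le> 0" using assms by (intro mass_upto_below_crit) simp
  moreover have "mass_upto (ereal K) = (LINT x|N. g x)"
    unfolding mass_upto_def set_lebesgue_integral_def
    using g_bounded by (intro Bochner_Integration.integral_cong) (auto simp: indicator_def abs_le_iff)
  ultimately show ?thesis by simp
qed

text \<open>The supremum gives signs only strictly below and strictly above \<beta>. The sublevel
  sets at \<beta> - 1/(n+1) increase to {g < \<beta>} and those at \<beta> + 1/(n+1) decrease to {g
  \<le> \<beta>}, so dominated convergence with the constant bound \<open>K\<close> carries the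
  signs to the limit.\<close>

lemma mass_at_crit:
  assumes "crit = ereal \<beta>"
  shows "(LINT x:{x \<in> space N. g x < \<beta>}|N. g x) \<le> 0"
    and "0 \<le> (LINT x:{x \<in> space N. g x \<le> \<beta>}|N. g x)"
proof -
  have small: "\<forall>\<^sub>F n in sequentially. inverse (real (Suc n)) < e" if "0 < e" for e
    using order_tendstoD(2)[OF LIMSEQ_inverse_real_of_nat that] .
  have "(\<lambda>n. LINT x|N. indicator {x \<in> space N. g x \<le> \<beta> - inverse (real (Suc n))} x *\<^sub>R g x)
          \<longlonglongrightarrow> (LINT x|N. indicator {x \<in> space N. g x < \<beta>} x *\<^sub>R g x)"
  proof (rule integral_dominated_convergence[where w = "\<lambda>_. K"])
    \<comment> \<open>At each point the sequence is eventually constant: from 1/(n+1) < \<beta> - g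
      x on if g x < \<beta>, and from the start otherwise.\<close>
    show "AE x in N. (\<lambda>n. indicator {x \<in> space N. g x \<le> \<beta> - inverse (real (Suc n))} x *\<^sub>R g x)
            \<longlonglongrightarrow> indicator {x \<in> space N. g x < \<beta>} x *\<^sub>R g x"
    proof (rule AE_I2, rule tendsto_eventually)
      fix x
      show "\<forall>\<^sub>F n in sequentially. indicator {x \<in> space N. g x \<le> \<beta> - inverse (real (Suc n))} x *\<^sub>R g x
              = indicator {x \<in> space N. g x < \<beta>} x *\<^sub>R g x"
      proof (cases "g x < \<beta>")
        case True
        then have "\<forall>\<^sub>F n in sequentially. inverse (real (Suc n)) < \<beta> - g x" by (intro small) simp
        then show ?thesis by eventually_elim (use True in \<open>auto simp: indicator_def\<close>)
      next
        case False
        have "\<not> g x \<le> \<beta> - inverse (real (Suc n))" for n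
          using False inverse_positive_iff_positive[of "real (Suc n)"] by linarith
        then show ?thesis using False by (simp add: indicator_def)
      qed
    qed
  qed (auto intro!: AE_I2 indicator_g_bounded[unfolded real_norm_def] simp del: real_scaleR_def)
  moreover have "(LINT x|N. indicator {x \<in> space N. g x \<le> \<beta> - inverse (real (Suc n))} x *\<^sub>R g x) \<le> 0" for n
    using mass_upto_below_crit[of "ereal (\<beta> - inverse (real (Suc n)))"] assms
    by (simp add: mass_upto_def set_lebesgue_integral_def del: of_nat_Suc)
  ultimately show "(LINT x:{x \<in> space N. g x < \<beta>}|N. g x) \<le> 0"
    unfolding set_lebesgue_integral_def by - (rule LIMSEQ_le_const2, assumption, blast)
  have "(\<lambda>n. LINT x|N. indicator {x \<in> space N. g x \<le> \<beta> + inverse (real (Suc n))} x *\<^sub>R g x)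
          \<longlonglongrightarrow> (LINT x|N. indicator {x \<in> space N. g x \<le> \<beta>} x *\<^sub>R g x)"
  proof (rule integral_dominated_convergence[where w = "\<lambda>_. K"])
    show "AE x in N. (\<lambda>n. indicator {x \<in> space N. g x \<le> \<beta> + inverse (real (Suc n))} x *\<^sub>R g x)
            \<longlonglongrightarrow> indicator {x \<in> space N. g x \<le> \<beta>} x *\<^sub>R g x"
    proof (rule AE_I2, rule tendsto_eventually)
      fix x
      show "\<forall>\<^sub>F n in sequentially. indicator {x \<in> space N. g x \<le> \<beta> + inverse (real (Suc n))} x *\<^sub>R g x
              = indicator {x \<in> space N. g x \<le> \<beta>} x *\<^sub>R g x"
      proof (cases "g x \<le> \<beta>")
        case True
        have "g x \<le> \<beta> + inverse (real (Suc n))" for n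
          using True inverse_positive_iff_positive[of "real (Suc n)"] by linarith
        then show ?thesis using True by (simp add: indicator_def)
      next
        case False
        then have "\<forall>\<^sub>F n in sequentially. inverse (real (Suc n)) < g x - \<beta>" by (intro small) simp
        then show ?thesis by eventually_elim (use False in \<open>auto simp: indicator_def\<close>)
      qed
    qed
  qed (auto intro!: AE_I2 indicator_g_bounded[unfolded real_norm_def] simp del: real_scaleR_def)
  moreover have "0 \<le> (LINT x|N. indicator {x \<in> space N. g x \<le> \<beta> + inverse (real (Suc n))} x *\<^sub>R g x)" for n
    using mass_upto_above_crit[of "\<beta> + inverse (real (Suc n))"] assms
    by (simp add: mass_upto_def set_lebesgue_integral_def del: of_nat_Suc)
  ultimately show "0 \<le> (LINT x:{x \<in> space N. g x \<le> \<beta>}|N. g x)"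
    unfolding set_lebesgue_integral_def by - (rule LIMSEQ_le_const, assumption, blast)
qed

section \<open>The selection problem for a bounded score\<close>

text \<open>This is \<open>feasible\<close> with the denominator of the selective risk cleared,
  where \<open>g\<close> stands for risk minus target. The risk constraint becomes linear in
  \<open>c\<close>.\<close>

definition admissible :: "('x \<Rightarrow> real) \<Rightarrow> bool" where
  "admissible c \<longleftrightarrow> selection_function N c \<and> (LINT x|N. c x) \<noteq> 0 \<and> (LINT x|N. g x * c x) \<le> 0"

definition maximal :: "('x \<Rightarrow> real) \<Rightarrow> bool" where
  "maximal c \<longleftrightarrow> admissible c \<and> (\<forall>c'. admissible c' \<longrightarrow> (LINT x|N. c' x) \<le> (LINT x|N. c x))"

lemma selection_functionD:
  assumes "selection_function N c"
  shows "c \<in> borel_measurable N" "\<And>x. x \<in> space N \<Longrightarrow> 0 \<le> c x" "\<And>x. x \<in> space N \<Longrightarrow> c x \<le> 1"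
  using assms by (auto simp: selection_function_def)

text \<open>Both \<open>c\<close> and \<open>1 - c\<close> are nonnegative, and a nonnegative
  function with integral 0 vanishes almost everywhere. Thus the extreme values of the mass selected
  on \<open>A\<close> are statements about \<open>c\<close> almost everywhere on
  \<open>A\<close>.\<close>

lemma set_integral_selection:
  assumes "selection_function N c" "A \<in> sets N"
  shows "(LINT x:A|N. c x) = 0 \<longleftrightarrow> (AE x in N. x \<in> A \<longrightarrow> c x = 0)"
    and "(LINT x:A|N. c x) = measure N A \<longleftrightarrow> (AE x in N. x \<in> A \<longrightarrow> c x = 1)"
    and "0 \<le> (LINT x:A|N. c x)" "(LINT x:A|N. c x) \<le> measure N A"
proof -
  note c = selection_functionD[OF assms(1)] and [measurable] = selection_functionD(1)[OF assms(1)] assms(2)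
  have int: "integrable N (\<lambda>x. indicator A x * c x)" "integrable N (\<lambda>x. indicator A x * (1 - c x))"
    using c by (auto intro!: integrable_bounded[where B = 1] simp: indicator_def)
  have A: "(LINT x|N. indicator A x) = measure N A"
    using sets.sets_into_space[OF assms(2)] by (simp add: Int_absorb2)
  have iA: "integrable N (indicator A :: 'x \<Rightarrow> real)"
    by (rule integrable_bounded[where B = 1]) (auto simp: indicator_def)
  have diff: "(LINT x|N. indicator A x * (1 - c x)) = measure N A - (LINT x|N. indicator A x * c x)"
    using int(1) iA by (simp add: right_diff_distrib A)
  have nn: "AE x in N. 0 \<le> indicator A x * c x" "AE x in N. 0 \<le> indicator A x * (1 - c x)"
    using c by auto
  show "0 \<le> (LINT x:A|N. c x)" "(LINT x:A|N. c x) \<le> measure N A"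
    using integral_nonneg_AE[OF nn(1)] integral_nonneg_AE[OF nn(2)] diff
    by (simp_all add: set_lebesgue_integral_def)
  show "(LINT x:A|N. c x) = 0 \<longleftrightarrow> (AE x in N. x \<in> A \<longrightarrow> c x = 0)"
    using integral_nonneg_eq_0_iff_AE[OF int(1) nn(1)]
    by (simp add: set_lebesgue_integral_def indicator_def)
  have "(LINT x:A|N. c x) = measure N A \<longleftrightarrow> (LINT x|N. indicator A x * (1 - c x)) = 0"
    unfolding diff by (auto simp: set_lebesgue_integral_def)
  also have "\<dots> \<longleftrightarrow> (AE x in N. x \<in> A \<longrightarrow> c x = 1)"
    unfolding integral_nonneg_eq_0_iff_AE[OF int(2) nn(2)]
    by (intro AE_cong) (auto simp: indicator_def)
  finally show "(LINT x:A|N. c x) = measure N A \<longleftrightarrow> (AE x in N. x \<in> A \<longrightarrow> c x = 1)" .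
qed

text \<open>Selecting everything satisfies the constraint, so the maximal coverage is the total
  mass. Conversely, full coverage forces \<open>c\<close> to be 1 almost everywhere, which makes
  \<open>c\<close> itself admissible.\<close>

lemma maximal_iff_infinite:
  assumes "(LINT x|N. g x) \<le> 0" "admissible c\<^sub>1" "selection_function N c"
  shows "maximal c \<longleftrightarrow> (LINT x|N. c x) = measure N (space N)"
proof -
  have full: "(LINT x:space N|N. f x) = (LINT x|N. f x)" for f :: "'x \<Rightarrow> real"
    unfolding set_lebesgue_integral_def by (rule Bochner_Integration.integral_cong) auto
  note S = set_integral_selection[where A = "space N", unfolded full, OF _ sets.top]
  \<comment> \<open>The nonzero coverage of \<open>c\<^sub>1\<close> excludes the null measure, for
    which nothing would be admissible.\<close>
  have pos: "measure N (space N) \<noteq> 0"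
    using assms(2) S(3,4)[of c\<^sub>1] by (auto simp: admissible_def)
  have "admissible c'" if "selection_function N c'" "(LINT x|N. c' x) = measure N (space N)" for c'
  proof -
    note [measurable] = selection_functionD(1)[OF that(1)]
    have "AE x in N. c' x = 1" using S(2)[OF that(1)] that(2) by simp
    then have "(LINT x|N. g x * c' x) = (LINT x|N. g x)" by (intro integral_cong_AE) auto
    then show ?thesis using that assms(1) pos by (simp add: admissible_def)
  qed
  note adm = this
  have one: "selection_function N (\<lambda>_. 1)" by (simp add: selection_function_def)
  show ?thesis
  proof
    assume "maximal c"
    moreover have "admissible (\<lambda>_. 1)" by (rule adm[OF one]) simp
    ultimately have "(LINT x|N. 1) \<le> (LINT x|N. c x)" unfolding maximal_def by blast
    then show "(LINT x|N. c x) = measure N (space N)"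
      using S(4)[OF assms(3)] by simp
  next
    assume "(LINT x|N. c x) = measure N (space N)"
    then show "maximal c" using adm[OF assms(3)] S(4) by (auto simp: maximal_def admissible_def)
  qed
qed

text \<open>\<open>balance\<close> says that all of \<open>L\<close> together with mass
  \<open>E\<close> from \<open>Q\<close> has total excess exactly 0. As \<open>g\<close> is constant
  on \<open>Q\<close>, only the mass taken there matters, not its distribution. The Lagrangian slack
  shows that no coverage beats this choice and identifies the cases of equality.\<close>

lemma maximal_iff_finite:
  fixes \<beta> E :: real
  defines "L \<equiv> {x \<in> space N. g x < \<beta>}" and "Q \<equiv> {x \<in> space N. g x = \<beta>}"
    and "U \<equiv> {x \<in> space N. \<beta> < g x}"
  assumes "0 \<le> \<beta>" "0 \<le> E" "E \<le> measure N Q" "\<beta> = 0 \<Longrightarrow> E = measure N Q"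
    and balance: "(LINT x:L|N. g x) + \<beta> * E = 0"
    and "admissible c\<^sub>1" "selection_function N c"
  shows "maximal c \<longleftrightarrow>
    (LINT x:L|N. c x) = measure N L \<and> (LINT x:Q|N. c x) = E \<and> (LINT x:U|N. c x) = 0"
proof -
  have [measurable]: "L \<in> sets N" "Q \<in> sets N" "U \<in> sets N" by (auto simp: L_def Q_def U_def)
  define V where "V = measure N L + E"
  \<comment> \<open>The two factors never have opposite signs: on \<open>L\<close> they are 1 - c x
    \<ge> 0 and \<beta> - g x > 0, and off \<open>L\<close> they are - c x \<le> 0 and \<beta> - g x
    \<le> 0.\<close>
  define slack where "slack c = (LINT x|N. (indicator L x - c x) * (\<beta> - g x))" for c
  have bound: "\<bar>s * (\<beta> - g x)\<bar> \<le> \<beta> + K" if "\<bar>s\<bar> \<le> 1" "x \<in> space N" for s x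
    using mult_mono[of "\<bar>s\<bar>" 1 "\<bar>\<beta> - g x\<bar>" "\<beta> + K"] that g_bounded[OF that(2)] \<open>0 \<le> \<beta>\<close>
    by (auto simp: abs_mult)
  have cover: "(LINT x|N. c x) = (LINT x:L|N. c x) + (LINT x:Q|N. c x) + (LINT x:U|N. c x)"
    if "selection_function N c" for c
  proof -
    note c = selection_functionD[OF that] and [measurable] = selection_functionD(1)[OF that]
    have i: "integrable N (\<lambda>x. indicator A x * c x)" if [measurable]: "A \<in> sets N" for A
      using c by (auto intro!: integrable_bounded[where B = 1] simp: indicator_def)
    have "(LINT x|N. c x) = (LINT x|N. indicator L x * c x + indicator Q x * c x + indicator U x * c x)"
      by (rule Bochner_Integration.integral_cong) (auto simp: L_def Q_def U_def indicator_def)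
    then show ?thesis using i by (simp add: set_lebesgue_integral_def)
  qed
  have slack_int: "integrable N (\<lambda>x. (indicator L x - c x) * (\<beta> - g x))"
    and slack_nn: "\<And>x. x \<in> space N \<Longrightarrow> 0 \<le> (indicator L x - c x) * (\<beta> - g x)"
    if "selection_function N c" for c
  proof -
    note c = selection_functionD[OF that] and [measurable] = selection_functionD(1)[OF that]
    show "integrable N (\<lambda>x. (indicator L x - c x) * (\<beta> - g x))"
    proof (intro integrable_bounded[where B = "\<beta> + K"] bound)
      show "\<bar>indicator L x - c x\<bar> \<le> 1" if "x \<in> space N" for x
        using c(2,3)[OF that] by (auto simp: indicator_def abs_le_iff)
    qed auto
    show "0 \<le> (indicator L x - c x) * (\<beta> - g x)" if "x \<in> space N" for x
      using c(2,3)[OF that] that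
      by (cases "g x < \<beta>") (auto simp: L_def indicator_def mult_nonneg_nonpos)
  qed
  have slack_nonneg: "0 \<le> slack c" if "selection_function N c" for c
    unfolding slack_def using slack_nn[OF that] by (intro integral_nonneg_AE AE_I2)
  \<comment> \<open>On \<open>Q\<close> the factor \<beta> - g x vanishes, so zero slack leaves
    \<open>c\<close> free there; the mass on \<open>Q\<close> has to be recovered from the total
    coverage.\<close>
  have slack_eq_0: "slack c = 0 \<longleftrightarrow> (LINT x:L|N. c x) = measure N L \<and> (LINT x:U|N. c x) = 0"
    if "selection_function N c" for c
  proof -
    have "slack c = 0 \<longleftrightarrow> (AE x in N. (indicator L x - c x) * (\<beta> - g x) = 0)"
      unfolding slack_def
      using slack_nn[OF that] by (intro integral_nonneg_eq_0_iff_AE slack_int[OF that] AE_I2)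
    also have "\<dots> \<longleftrightarrow> (AE x in N. (x \<in> L \<longrightarrow> c x = 1) \<and> (x \<in> U \<longrightarrow> c x = 0))"
      by (intro AE_cong) (auto simp: L_def U_def indicator_def)
    finally show ?thesis
      by (simp add: set_integral_selection[OF that])
  qed
  \<comment> \<open>After expanding the product, \<open>balance\<close> replaces the integral of
    \<open>g\<close> over \<open>L\<close> by - \<beta> * \<open>E\<close>, which combines with
    \<beta> times the measure of \<open>L\<close> to \<beta> * \<open>V\<close>.\<close>
  have slack_eq: "slack c = \<beta> * (V - (LINT x|N. c x)) + (LINT x|N. g x * c x)"
    if "selection_function N c" for c
  proof -
    note c = selection_functionD[OF that] and [measurable] = selection_functionD(1)[OF that]
    have i: "integrable N (indicator L :: 'x \<Rightarrow> real)" "integrable N (\<lambda>x. indicator L x * g x)"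
      "integrable N c" "integrable N (\<lambda>x. g x * c x)"
      subgoal by (rule integrable_bounded[where B = 1]) (auto simp: indicator_def)
      subgoal using integrable_mult_indicator[OF _ integrable_g, of L] by simp
      subgoal using c by (intro integrable_bounded[where B = 1]) auto
      subgoal using c by (intro Bochner_Integration.integrable_bound[OF integrable_g])
          (auto simp: abs_mult intro!: mult_left_le)
      done
    have "L \<inter> space N = L" by (auto simp: L_def)
    then have L: "(LINT x|N. indicator L x) = measure N L" by simp
    have "slack c = (LINT x|N. \<beta> * indicator L x - indicator L x * g x - \<beta> * c x + g x * c x)"
      unfolding slack_def by (intro Bochner_Integration.integral_cong) (auto simp: algebra_simps)
    also have "\<dots> = \<beta> * measure N L - (LINT x:L|N. g x) - \<beta> * (LINT x|N. c x) + (LINT x|N. g x * c x)"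
      using i by (simp add: L set_lebesgue_integral_def)
    finally show ?thesis using balance by (simp add: V_def algebra_simps)
  qed
  have upper: "(LINT x|N. c x) \<le> V" if "admissible c" for c
  proof (cases "\<beta> = 0")
    case False
    from that have sc: "selection_function N c" and "(LINT x|N. g x * c x) \<le> 0"
      by (auto simp: admissible_def)
    then have "0 \<le> \<beta> * (V - (LINT x|N. c x))"
      using slack_nonneg[OF sc] slack_eq[OF sc] by linarith
    then show ?thesis using False \<open>0 \<le> \<beta>\<close> by (simp add: zero_le_mult_iff)
  next
    \<comment> \<open>Now the coverage drops out of the slack identity, and the slack equals the
      integral of g x * c x, which is at most 0. Hence it vanishes, so the coverage is the measure
      of \<open>L\<close> plus the mass on \<open>Q\<close>, and the latter is at most
      \<open>E\<close>.\<close>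
    case True
    from that have sc: "selection_function N c" and "(LINT x|N. g x * c x) \<le> 0"
      by (auto simp: admissible_def)
    then have "slack c = 0" using slack_nonneg[OF sc] slack_eq[OF sc] True by simp
    then show ?thesis
      using slack_eq_0[OF sc] cover[OF sc] set_integral_selection(4)[OF sc \<open>Q \<in> sets N\<close>]
        assms(7)[OF True] by (simp add: V_def)
  qed
  have "0 \<le> (LINT x|N. c\<^sub>1 x)" "(LINT x|N. c\<^sub>1 x) \<noteq> 0"
    using \<open>admissible c\<^sub>1\<close>
    by (auto simp: admissible_def selection_function_def intro!: integral_nonneg_AE)
  \<comment> \<open>Positivity of \<open>V\<close> is what gives the candidates below the nonzero
    coverage required for admissibility.\<close>
  then have "0 < V" using upper[OF \<open>admissible c\<^sub>1\<close>] by linarith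
  have attains: "admissible c" "(LINT x|N. c x) = V"
    if sc: "selection_function N c" and cond: "(LINT x:L|N. c x) = measure N L" "(LINT x:Q|N. c x) = E"
      "(LINT x:U|N. c x) = 0" for c
  proof -
    show V: "(LINT x|N. c x) = V" using cover[OF sc] cond by (simp add: V_def)
    have "(LINT x|N. g x * c x) = 0" using slack_eq[OF sc] slack_eq_0[OF sc] cond V by simp
    then show "admissible c" using sc V \<open>0 < V\<close> by (simp add: admissible_def)
  qed
  \<comment> \<open>A witness that \<open>V\<close> is attained: the mass \<open>E\<close> is spread
    evenly over \<open>Q\<close>. If \<open>Q\<close> is a null set, then \<open>E\<close> = 0 and
    the quotient 0 / 0 is 0, so the prescribed mass is still correct.\<close>
  define c\<^sub>0 :: "'x \<Rightarrow> real" where "c\<^sub>0 x = indicator L x + E / measure N Q * indicator Q x" for x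
  have c0: "selection_function N c\<^sub>0"
    unfolding selection_function_def
  proof (intro conjI ballI)
    show "c\<^sub>0 \<in> borel_measurable N" unfolding c\<^sub>0_def by measurable
    have "0 \<le> E / measure N Q" "E / measure N Q \<le> 1"
      using assms(5,6) by (auto simp: divide_le_eq_1 order_le_less)
    then show "c\<^sub>0 x \<in> {0..1}" if "x \<in> space N" for x
      by (auto simp: c\<^sub>0_def L_def Q_def indicator_def)
  qed
  have max_value: "(LINT x|N. c\<^sub>0 x) = V" "admissible c\<^sub>0"
  proof -
    have sub: "L \<inter> space N = L" "Q \<inter> space N = Q" by (auto simp: L_def Q_def)
    have "(LINT x:L|N. c\<^sub>0 x) = (LINT x|N. indicator L x)"
      unfolding set_lebesgue_integral_def
      by (intro Bochner_Integration.integral_cong) (auto simp: c\<^sub>0_def L_def Q_def indicator_def)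
    moreover have "(LINT x:Q|N. c\<^sub>0 x) = (LINT x|N. E / measure N Q * indicator Q x)"
      unfolding set_lebesgue_integral_def
      by (intro Bochner_Integration.integral_cong) (auto simp: c\<^sub>0_def L_def Q_def indicator_def)
    moreover have "(LINT x:U|N. c\<^sub>0 x) = (LINT x|N. 0)"
      unfolding set_lebesgue_integral_def
      by (intro Bochner_Integration.integral_cong) (auto simp: c\<^sub>0_def L_def Q_def U_def indicator_def)
    ultimately have "(LINT x:L|N. c\<^sub>0 x) = measure N L" "(LINT x:Q|N. c\<^sub>0 x) = E" "(LINT x:U|N. c\<^sub>0 x) = 0"
      using assms(5,6) by (auto simp: sub)
    then show "(LINT x|N. c\<^sub>0 x) = V" "admissible c\<^sub>0" using attains[OF c0] by auto
  qed
  show ?thesis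
  proof
    assume "maximal c"
    then have G: "(LINT x|N. g x * c x) \<le> 0" and "V \<le> (LINT x|N. c x)" and "admissible c"
      using max_value by (auto simp: maximal_def admissible_def)
    then have V: "(LINT x|N. c x) = V" using upper by (simp add: antisym)
    \<comment> \<open>At coverage \<open>V\<close> only the integral of g x * c x remains in the
      slack identity. It is at most 0 while the slack is at least 0. The mass on \<open>Q\<close> is
      then what is left of \<open>V\<close>.\<close>
    then have "slack c = 0"
      using slack_eq[OF assms(10)] slack_nonneg[OF assms(10)] G by simp
    then show "(LINT x:L|N. c x) = measure N L \<and> (LINT x:Q|N. c x) = E \<and> (LINT x:U|N. c x) = 0"
      using slack_eq_0[OF assms(10)] cover[OF assms(10)] V by (simp add: V_def)
  next
    assume "(LINT x:L|N. c x) = measure N L \<and> (LINT x:Q|N. c x) = E \<and> (LINT x:U|N. c x) = 0"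
    then show "maximal c" using attains[OF assms(10)] upper by (auto simp: maximal_def)
  qed
qed

text \<open>For \<beta> > 0 the prescribed mass is the solution \<open>E\<close> of the balance
  equation, and the two signs at \<beta> say that it lies between 0 and the measure of
  \<open>Q\<close>. For \<beta> = 0 the same signs force the integral of \<open>g\<close> over
  \<open>L\<close> to be 0, so balance holds with all of \<open>Q\<close> selected.\<close>

lemma maximal_iff_crit:
  assumes "crit = ereal \<beta>"
  defines "L \<equiv> {x \<in> space N. g x < \<beta>}" and "Q \<equiv> {x \<in> space N. g x = \<beta>}"
    and "U \<equiv> {x \<in> space N. \<beta> < g x}"
  assumes "admissible c\<^sub>1" "selection_function N c"
  shows "maximal c \<longleftrightarrow>
    (LINT x:L|N. c x) = measure N L \<and>
    (LINT x:Q|N. c x) = (if \<beta> > 0 then - ((LINT x:L|N. g x) / \<beta>) else measure N Q) \<and>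
    (LINT x:U|N. c x) = 0"
proof -
  have [measurable]: "L \<in> sets N" "Q \<in> sets N" by (auto simp: L_def Q_def)
  have "0 \<le> \<beta>" using crit_nonneg assms(1) by simp
  have int: "integrable N (\<lambda>x. indicator L x * g x)" "integrable N (indicator Q :: 'x \<Rightarrow> real)"
    subgoal using integrable_mult_indicator[OF _ integrable_g, of L] by simp
    subgoal by (rule integrable_bounded[where B = 1]) (auto simp: indicator_def)
    done
  have sub: "Q \<inter> space N = Q" by (auto simp: Q_def)
  have "(LINT x:{x \<in> space N. g x \<le> \<beta>}|N. g x)
      = (LINT x|N. indicator L x * g x + \<beta> * indicator Q x)"
    unfolding set_lebesgue_integral_def
    by (intro Bochner_Integration.integral_cong) (auto simp: L_def Q_def indicator_def)
  also have "\<dots> = (LINT x:L|N. g x) + \<beta> * measure N Q"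
    using int by (simp add: set_lebesgue_integral_def sub)
  finally have "0 \<le> (LINT x:L|N. g x) + \<beta> * measure N Q" "(LINT x:L|N. g x) \<le> 0"
    using mass_at_crit[OF assms(1)] by (simp_all add: L_def)
  then show ?thesis
    unfolding L_def Q_def U_def using \<open>0 \<le> \<beta>\<close>
    by (intro maximal_iff_finite[OF _ _ _ _ _ assms(5,6)]) (auto simp: field_simps)
qed

end

section \<open>The marginal distribution and the conditional risk\<close>

lemma marginal_measurable:
  assumes "joint_density M p"
  shows "marginal p \<in> borel_measurable M"
proof -
  have [measurable]: "p \<in> borel_measurable (M \<Otimes>\<^sub>M count_space UNIV)"
    using assms by (simp add: joint_density_def)
  show ?thesis unfolding marginal_def by measurable
qed

lemma marginal_nonneg: "joint_density M p \<Longrightarrow> x \<in> space M \<Longrightarrow> 0 \<le> marginal p x"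
  by (auto simp: joint_density_def marginal_def intro: sum_nonneg)

abbreviation marginal_measure :: "'x measure \<Rightarrow> ('x \<times> 'y::finite \<Rightarrow> real) \<Rightarrow> 'x measure" where
  "marginal_measure M p \<equiv> density M (\<lambda>x. ennreal (marginal p x))"

text \<open>The sum over labels is an integral against counting measure, so Tonelli identifies the
  total mass with that of the joint density.\<close>

lemma prob_space_marginal_measure:
  fixes p :: "'x \<times> 'y::finite \<Rightarrow> real"
  assumes "joint_density M p"
  shows "prob_space (marginal_measure M p)"
proof (rule prob_spaceI)
  interpret Y: sigma_finite_measure "count_space (UNIV :: 'y set)"
    by (rule sigma_finite_measure_count_space_finite) simp
  have [measurable]: "p \<in> borel_measurable (M \<Otimes>\<^sub>M count_space UNIV)"
    and nn: "\<And>x y. x \<in> space M \<Longrightarrow> 0 \<le> p (x, y)"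
    and P: "prob_space (density (M \<Otimes>\<^sub>M count_space UNIV) (\<lambda>z. ennreal (p z)))"
    using assms by (auto simp: joint_density_def)
  note [measurable] = marginal_measurable[OF assms]
  have "emeasure (marginal_measure M p) (space (marginal_measure M p))
      = (\<integral>\<^sup>+x. ennreal (marginal p x) \<partial>M)"
    by (simp add: emeasure_density cong: nn_integral_cong)
  also have "\<dots> = (\<integral>\<^sup>+x. (\<integral>\<^sup>+y. ennreal (p (x, y)) \<partial>count_space UNIV) \<partial>M)"
    by (intro nn_integral_cong) (simp add: marginal_def nn_integral_count_space_finite sum_ennreal nn)
  also have "\<dots> = (\<integral>\<^sup>+z. ennreal (p z) \<partial>(M \<Otimes>\<^sub>M count_space UNIV))"
    by (rule Y.nn_integral_fst) measurable
  also have "\<dots> = 1"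
    using prob_space.emeasure_space_1[OF P] by (simp add: emeasure_density cong: nn_integral_cong)
  finally show "emeasure (marginal_measure M p) (space (marginal_measure M p)) = 1" .
qed

lemma integral_marginal_measure:
  fixes f :: "'x \<Rightarrow> real"
  assumes "joint_density M p" "f \<in> borel_measurable M"
  shows "(LINT x|M. marginal p x * f x) = (LINT x|marginal_measure M p. f x)"
  using assms marginal_measurable[OF assms(1)] marginal_nonneg[OF assms(1)]
  by (simp add: integral_density)

lemma set_integral_marginal_measure:
  fixes f :: "'x \<Rightarrow> real"
  assumes "joint_density M p" "f \<in> borel_measurable M" "A \<in> sets M"
  shows "(LINT x:A|M. marginal p x * f x) = (LINT x:A|marginal_measure M p. f x)"
proof -
  have "(\<lambda>x. indicator A x * f x) \<in> borel_measurable M" using assms(2,3) by measurable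
  from integral_marginal_measure[OF assms(1) this] show ?thesis
    by (simp add: set_lebesgue_integral_def ac_simps)
qed

text \<open>The risk is an average of losses with probability weights. Any bound uniform in
  \<open>x\<close> serves to make the score bounded, so the sum of all losses suffices.\<close>

lemma conditional_risk_bounds:
  assumes "conditional_distribution M p q" "\<And>y y'. 0 \<le> loss y y'" "x \<in> space M"
  shows "0 \<le> conditional_risk q loss h x"
    and "conditional_risk q loss h x \<le> (\<Sum>y\<in>UNIV. \<Sum>y'\<in>UNIV. loss y y')"
proof -
  have q: "\<And>y. 0 \<le> q y x" "(\<Sum>y\<in>UNIV. q y x) = 1"
    using assms by (auto simp: conditional_distribution_def)
  show "0 \<le> conditional_risk q loss h x"
    unfolding conditional_risk_def using q assms(2) by (intro sum_nonneg mult_nonneg_nonneg)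
  have "q y x * loss y (h x) \<le> (\<Sum>y'\<in>UNIV. loss y y')" for y
  proof -
    have "q y x \<le> 1" using member_le_sum[of y UNIV "\<lambda>y. q y x"] q by simp
    then have "q y x * loss y (h x) \<le> loss y (h x)" using assms(2) by (simp add: mult_left_le_one_le q(1))
    also have "\<dots> \<le> (\<Sum>y'\<in>UNIV. loss y y')"
      using member_le_sum[of "h x" UNIV "loss y"] assms(2) by simp
    finally show ?thesis .
  qed
  then show "conditional_risk q loss h x \<le> (\<Sum>y\<in>UNIV. \<Sum>y'\<in>UNIV. loss y y')"
    unfolding conditional_risk_def by (intro sum_mono)
qed

lemma conditional_risk_measurable:
  assumes "conditional_distribution M p q" "h \<in> M \<rightarrow>\<^sub>M count_space UNIV"
  shows "conditional_risk q loss h \<in> borel_measurable M"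
proof -
  have [measurable]: "q y \<in> borel_measurable M" for y
    using assms(1) by (simp add: conditional_distribution_def)
  have [measurable]: "(\<lambda>x. loss y (h x)) \<in> borel_measurable M" for y
    by (rule measurable_compose[OF assms(2)]) simp
  show ?thesis unfolding conditional_risk_def by measurable
qed

section \<open>Optimal selection functions, by reduction to the excess risk under the marginal
  distribution\<close>

theorem theorem2:
  fixes M :: "'x measure"
    and p :: "'x \<times> 'y::finite \<Rightarrow> real"
    and q :: "'y \<Rightarrow> 'x \<Rightarrow> real"
    and loss :: "'y \<Rightarrow> 'y \<Rightarrow> real"
    and h :: "'x \<Rightarrow> 'y"
    and target :: real
    and cstar :: "'x \<Rightarrow> real"
  assumes "joint_density M p"
    and "conditional_distribution M p q"
    and "\<And>y y'. 0 \<le> loss y y'"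
    and "h \<in> M \<rightarrow>\<^sub>M count_space UNIV"
    and "0 < target"
    and "\<exists>c. optimal M p loss h target c"
    and "selection_function M cstar"
  shows
    "let rbar = (\<lambda>x. conditional_risk q loss h x - target);
         b = threshold M p rbar;
         X_less = {x \<in> space M. ereal (rbar x) < b};
         X_eq = {x \<in> space M. ereal (rbar x) = b};
         X_greater = {x \<in> space M. ereal (rbar x) > b}
     in 0 \<le> b \<and>
        (optimal M p loss h target cstar \<longleftrightarrow>
           (LINT x:X_less|M. marginal p x * cstar x) = (LINT x:X_less|M. marginal p x) \<and>
           (LINT x:X_eq|M. marginal p x * cstar x) =
             (if b = \<infinity> then 0
              else if b > 0 then - (rho M p rbar X_less / real_of_ereal b)
              else (LINT x:{x \<in> space M. rbar x = 0}|M. marginal p x)) \<and>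
           (LINT x:X_greater|M. marginal p x * cstar x) = 0)"
proof -
  define g where "g x = conditional_risk q loss h x - target" for x
  define N where "N = marginal_measure M p"
  \<comment> \<open>Since the risk lies between 0 and the sum of all losses and the target is
    positive, this bounds the absolute value of risk minus target.\<close>
  define K where "K = (\<Sum>y\<in>UNIV. \<Sum>y'\<in>UNIV. loss y y') + target"
  have [measurable]: "conditional_risk q loss h \<in> borel_measurable M"
    by (rule conditional_risk_measurable[OF assms(2,4)])
  have gM [measurable]: "g \<in> borel_measurable M" unfolding g_def by measurable
  interpret prob_space N unfolding N_def by (rule prob_space_marginal_measure[OF assms(1)])
  have spN: "space N = space M" and setsN: "sets N = sets M" by (simp_all add: N_def)
  have gN: "g \<in> borel_measurable N" using gM by (simp add: N_def)
  interpret bounded_score N g K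
  proof unfold_locales
    show "\<bar>g x\<bar> \<le> K" if "x \<in> space N" for x
    proof -
      have "x \<in> space M" using that spN by simp
      from conditional_risk_bounds[where loss = loss and h = h, OF assms(2,3) this] show ?thesis
        using assms(5) by (simp add: g_def K_def abs_le_iff)
    qed
  qed (fact gN)
  note transfer = set_integral_marginal_measure[OF assms(1), folded N_def]
  have selN: "selection_function N c \<longleftrightarrow> selection_function M c" for c
    by (simp add: selection_function_def N_def)
  have feasible: "feasible M p loss h target c \<longleftrightarrow> admissible c"
    and coverage: "coverage M p c = (LINT x|N. c x)" if "selection_function M c" for c
  proof -
    have [measurable]: "c \<in> borel_measurable M" and c: "\<And>x. x \<in> space M \<Longrightarrow> c x \<in> {0..1}"
      using that by (auto simp: selection_function_def)
    then have [measurable]: "c \<in> borel_measurable N" by (simp add: N_def)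
    show cov: "coverage M p c = (LINT x|N. c x)"
      unfolding coverage_def N_def by (rule integral_marginal_measure[OF assms(1)]) measurable
    have int: "integrable N c" "integrable N (\<lambda>x. g x * c x)"
      subgoal using c spN by (intro integrable_bounded[where B = 1]) auto
      subgoal using c spN by (intro Bochner_Integration.integrable_bound[OF integrable_g])
          (auto simp: abs_mult intro!: mult_left_le)
      done
    have "(LINT x|M. (\<Sum>y\<in>UNIV. p (x, y) * loss y (h x) * c x))
        = (LINT x|M. marginal p x * (conditional_risk q loss h x * c x))"
    proof (rule Bochner_Integration.integral_cong[OF refl])
      fix x assume "x \<in> space M"
      then have "p (x, y) = marginal p x * q y x" for y
        using assms(2) by (simp add: conditional_distribution_def)
      then show "(\<Sum>y\<in>UNIV. p (x, y) * loss y (h x) * c x)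
          = marginal p x * (conditional_risk q loss h x * c x)"
        by (simp add: conditional_risk_def sum_distrib_left sum_distrib_right mult.assoc)
    qed
    also have "\<dots> = (LINT x|N. conditional_risk q loss h x * c x)"
      unfolding N_def by (rule integral_marginal_measure[OF assms(1)]) measurable
    also have "\<dots> = (LINT x|N. g x * c x + target * c x)"
      by (simp add: g_def algebra_simps)
    also have "\<dots> = (LINT x|N. g x * c x) + target * (LINT x|N. c x)"
      using int by simp
    finally have risk: "selective_risk M p loss h c
        = ((LINT x|N. g x * c x) + target * (LINT x|N. c x)) / (LINT x|N. c x)"
      by (simp add: selective_risk_def cov)
    \<comment> \<open>A nonzero coverage is therefore positive, so the risk constraint can be
      multiplied by it; the two target terms then cancel.\<close>
    have "0 \<le> (LINT x|N. c x)"
      using c spN by (intro integral_nonneg_AE AE_I2) auto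
    then have "selective_risk M p loss h c \<le> target \<longleftrightarrow> (LINT x|N. g x * c x) \<le> 0"
      if "(LINT x|N. c x) \<noteq> 0"
      using that unfolding risk by (auto simp: divide_le_eq)
    then show "feasible M p loss h target c \<longleftrightarrow> admissible c"
      using that by (auto simp: feasible_def admissible_def cov selN)
  qed
  have feasible_iff: "feasible M p loss h target c \<longleftrightarrow> admissible c" for c
    using feasible[of c] by (auto simp: feasible_def admissible_def selN)
  have optimal_iff: "optimal M p loss h target c \<longleftrightarrow> maximal c" for c
    using coverage by (auto simp: optimal_def maximal_def feasible_iff admissible_def selN)
  have rho: "rho M p g A = (LINT x:A|N. g x)" if "A \<in> sets M" for A
    unfolding rho_def using that by (rule transfer[OF gM])
  have b: "threshold M p g = crit"
    unfolding threshold_def mass_upto_def spN by (subst rho) measurable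
  obtain c\<^sub>1 where c1: "admissible c\<^sub>1"
    using assms(6) by (auto simp: optimal_def feasible_iff)
  have cM: "cstar \<in> borel_measurable M" and cN: "selection_function N cstar"
    using assms(7) by (simp_all add: selN) (simp add: selection_function_def)
  have mass: "(LINT x:A|M. marginal p x) = measure N A" if "A \<in> sets M" for A
    using transfer[of "\<lambda>_. 1" A] that sets.sets_into_space[OF that]
    by (simp add: set_lebesgue_integral_def spN Int_absorb2)
  have sets: "{x \<in> space M. ereal (g x) < b'} \<in> sets M" "{x \<in> space M. ereal (g x) = b'} \<in> sets M"
    "{x \<in> space M. ereal (g x) > b'} \<in> sets M" for b'
    by measurable
  note eqs = transfer[OF cM] mass rho sets
  have "optimal M p loss h target cstar \<longleftrightarrow>
      (LINT x:{x \<in> space M. ereal (g x) < crit}|M. marginal p x * cstar x)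
        = (LINT x:{x \<in> space M. ereal (g x) < crit}|M. marginal p x) \<and>
      (LINT x:{x \<in> space M. ereal (g x) = crit}|M. marginal p x * cstar x) =
        (if crit = \<infinity> then 0
         else if crit > 0
           then - (rho M p g {x \<in> space M. ereal (g x) < crit} / real_of_ereal crit)
         else (LINT x:{x \<in> space M. g x = 0}|M. marginal p x)) \<and>
      (LINT x:{x \<in> space M. ereal (g x) > crit}|M. marginal p x * cstar x) = 0"
  proof (cases crit)
    \<comment> \<open>Every real score lies below \<infinity>, so the first set is the whole space
      and the other two are empty. The conditions collapse to full coverage, and the value 0
      prescribed in the middle one holds trivially.\<close>
    case PInf
    have "(LINT x:space N|N. cstar x) = (LINT x|N. cstar x)"
      unfolding set_lebesgue_integral_def by (rule Bochner_Integration.integral_cong) auto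
    moreover have "(LINT x:{}|N. cstar x) = 0" by (simp add: set_lebesgue_integral_def)
    ultimately show ?thesis
      using maximal_iff_infinite[OF integral_nonpos_if_crit_infinite[OF PInf] c1 cN]
      by (simp add: PInf eqs optimal_iff spN)
  next
    case (real \<beta>)
    have "0 \<le> \<beta>" using crit_nonneg real by simp
    \<comment> \<open>Identifies the level set {g = 0} of the last branch with {g =
      \<beta>}.\<close>
    then have zero: "\<not> 0 < \<beta> \<Longrightarrow> \<beta> = 0" by simp
    have *: "{x \<in> space M. g x < \<beta>} \<in> sets M" "{x \<in> space M. g x = \<beta>} \<in> sets M"
      "{x \<in> space M. \<beta> < g x} \<in> sets M"  "{x \<in> space M. g x = 0} \<in> sets M"
      by measurable
    show ?thesis
      using maximal_iff_crit[OF real c1 cN] zero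
      by (auto simp: real transfer[OF cM] mass rho * optimal_iff spN)
  next
    case MInf
    then show ?thesis using crit_nonneg by simp
  qed
  then show ?thesis
    unfolding Let_def g_def[symmetric] b by (rule conjI[OF crit_nonneg])
qed

end
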